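(* Let $n\ge 1$. The maximal simplices of the clique complex $K_n$ of the partition graph $G_n$ are exactly: (1) all full star-simplices $\Sigma^{\mathrm{star}}_{\max}(\lambda,c)$ with $|A_{\max}(\lambda,c)|\ge 2$ (where $\lambda$ is a partition of $n$ and $c$ a removable corner of $\lambda$); (2) all full top-simplices $\Sigma^{\mathrm{top}}_{\max}(\lambda,a)$ with $|C_{\max}(\lambda,a)|\ge 2$ (where $\lambda$ is a partition of $n$ and $a$ an addable corner of $\lambda$); (3) all edges $\{\lambda,\lambda(c\to a)\}$ (with $\lambda(c\to a)$ an admissible transfer) such that $|A_{\max}(\lambda,c)|=1$ and $|C_{\max}(\lambda,a)|=1$.
   Context: A partition of $n$ is a weakly decreasing sequence $\lambda=(\lambda_1\ge\cdots\ge\lambda_\ell>0)$ of positive integers with sum $n$, identified with its Ferrers diagram ($\lambda_i$ left-justified cells in row $i$); set $\lambda_{\ell+1}=0$. The partition graph $G_n$ has as vertices all partitions of $n$; two distinct partitions are adjacent if one is obtained from the other by removing one cell from a row, adding it to another row (possibly a new row of length $0$), and reordering the row lengths into weakly decreasing order. $K_n$ is the clique complex of $G_n$: its simplices are the finite nonempty cliques of $G_n$. A simplex is maximal if it is not properly contained in another simplex of $K_n$. A removable corner of $\lambda$ is the last cell of a row whose length is strictly greater than that of the next row; an addable corner is a position where a cell can be added so that the result is again a Ferrers diagram of a partition (row $\ell+1$ allowed). Write $r(\cdot)$ for the row number of a corner. For a removable corner $c$ and an addable corner $a$ of $\lambda$ with $r(c)\ne r(a)$, remove $c$ (decrease $\lambda_{r(c)}$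 by $1$), add a cell at $a$ (increase $\lambda_{r(a)}$ by $1$), and reorder row lengths. If the result is a partition of $n$ different from $\lambda$, the transfer is called admissible and the result is denoted $\lambda(c\to a)$. The neighbors of $\lambda$ in $G_n$ are exactly the partitions $\lambda(c\to a)$ for admissible transfers. For a removable corner $c$ of $\lambda$: $A_{\max}(\lambda,c):=\{a:\lambda(c\to a)\text{ is admissible}\}$ and the full star-simplex is $\Sigma^{\mathrm{star}}_{\max}(\lambda,c):=\{\lambda\}\cup\{\lambda(c\to a):a\in A_{\max}(\lambda,c)\}$. For an addable corner $a$ of $\lambda$: $C_{\max}(\lambda,a):=\{c:\lambda(c\to a)\text{ is admissible}\}$ and the full top-simplex is $\Sigma^{\mathrm{top}}_{\max}(\lambda,a):=\{\lambda\}\cup\{\lambda(c\to a):c\in C_{\max}(\lambda,a)\}$. These are simplices of $K_n$.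
   Formalization: The statement fails for n = 1, where the single vertex (1) is the only maximal simplex but no transfer is admissible and families (1)–(3) are empty; the equality is proved for all n ≥ 2, and for n = 1 the maximal simplices are shown to be just {(1)}. *)

theory Defs
  imports Main "HOL-Library.Ramsey" "HOL-Library.More_List"
begin

text \<open>
  A partition is the weakly decreasing list of its (positive) row lengths.
  Rows and columns are numbered from 0, so row \<open>length l\<close> is the empty row below the diagram.
\<close>

definition partitions :: "nat \<Rightarrow> nat list set" where
  "partitions n = {l. sorted_wrt (\<ge>) l \<and> (\<forall>x\<in>set l. 0 < x) \<and> sum_list l = n}"

definition ferrers :: "nat list \<Rightarrow> (nat \<times> nat) set" where
  "ferrers l = {(i, j). i < length l \<and> j < l ! i}"

text \<open>
  Only meaningful for \<open>i < length l\<close>, \<open>j \<le> length l\<close> and \<open>i \<noteq> j\<close>.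
  A row that has become empty disappears from the list.
\<close>

definition move_cell :: "nat list \<Rightarrow> nat \<Rightarrow> nat \<Rightarrow> nat list" where
  "move_cell l i j =
     (let r = l @ [0]
      in rev (sort (filter (\<lambda>x. 0 < x) (r[i := r ! i - 1, j := r ! j + 1]))))"

definition obtained_by_move :: "nat list \<Rightarrow> nat list \<Rightarrow> bool" where
  "obtained_by_move l m \<longleftrightarrow> (\<exists>i < length l. \<exists>j \<le> length l. i \<noteq> j \<and> m = move_cell l i j)"

definition partition_graph_edges :: "nat \<Rightarrow> nat list set set" where
  "partition_graph_edges n =
     {{l, m} | l m. l \<in> partitions n \<and> m \<in> partitions n \<and> l \<noteq> m \<and>
                    (obtained_by_move l m \<or> obtained_by_move m l)}"

definition clique_complex :: "'a set \<Rightarrow> 'a set set \<Rightarrow> 'a set set" where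
  "clique_complex V E = {S. S \<subseteq> V \<and> finite S \<and> S \<noteq> {} \<and> clique S E}"

definition maximal_simplices :: "'a set set \<Rightarrow> 'a set set" where
  "maximal_simplices K = {S \<in> K. \<not> (\<exists>T\<in>K. S \<subset> T)}"

definition partition_complex :: "nat \<Rightarrow> nat list set set" where
  "partition_complex n = clique_complex (partitions n) (partition_graph_edges n)"

text \<open>Corners are cells; the row number of a corner \<open>c\<close> is \<open>fst c\<close>.\<close>

definition removable_corner :: "nat list \<Rightarrow> nat \<times> nat \<Rightarrow> bool" where
  "removable_corner l c \<longleftrightarrow>
     (\<exists>i < length l. l ! i > nth_default 0 l (Suc i) \<and> c = (i, l ! i - 1))"

definition addable_corner :: "nat list \<Rightarrow> nat \<times> nat \<Rightarrow> bool" where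
  "addable_corner l a \<longleftrightarrow>
     a \<notin> ferrers l \<and> (\<exists>m \<in> partitions (Suc (sum_list l)). ferrers m = insert a (ferrers l))"

definition corner_transfer :: "nat list \<Rightarrow> nat \<times> nat \<Rightarrow> nat \<times> nat \<Rightarrow> nat list" where
  "corner_transfer l c a = move_cell l (fst c) (fst a)"

definition admissible :: "nat list \<Rightarrow> nat \<times> nat \<Rightarrow> nat \<times> nat \<Rightarrow> bool" where
  "admissible l c a \<longleftrightarrow>
     removable_corner l c \<and> addable_corner l a \<and> fst c \<noteq> fst a \<and>
     corner_transfer l c a \<in> partitions (sum_list l) \<and> corner_transfer l c a \<noteq> l"

definition A_max :: "nat list \<Rightarrow> nat \<times> nat \<Rightarrow> (nat \<times> nat) set" where
  "A_max l c = {a. admissible l c a}"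

definition C_max :: "nat list \<Rightarrow> nat \<times> nat \<Rightarrow> (nat \<times> nat) set" where
  "C_max l a = {c. admissible l c a}"

definition star_simplex :: "nat list \<Rightarrow> nat \<times> nat \<Rightarrow> nat list set" where
  "star_simplex l c = {l} \<union> {corner_transfer l c a | a. a \<in> A_max l c}"

definition top_simplex :: "nat list \<Rightarrow> nat \<times> nat \<Rightarrow> nat list set" where
  "top_simplex l a = {l} \<union> {corner_transfer l c a | c. c \<in> C_max l a}"

end

theory Submission
  imports Defs "HOL-Library.Multiset"
begin

text \<open>
  Encode a partition by its row length function, a weakly decreasing sequence \<open>f\<close> of natural
  numbers, and write \<open>e\<^sub>i\<close> for the \<open>i\<close>-th unit vector. Two partitions are adjacent iff their
  difference is a root \<open>e\<^sub>j - e\<^sub>i\<close> with \<open>i \<noteq> j\<close>, that is, iff they are \<open>f + e\<^sub>i\<close> and \<open>f + e\<^sub>j\<close>,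
  where the meet \<open>f\<close> and the join \<open>f + e\<^sub>i + e\<^sub>j\<close> are again partitions. A clique containing these
  two vertices lies in one of the two cliques \<open>U = {f + e\<^sub>k}\<close> and \<open>D = {f + e\<^sub>i + e\<^sub>j - e\<^sub>k}\<close>,
  and \<open>U \<inter> D\<close> consists of the two vertices only. The sets \<open>U\<close> are the full star-simplices, the
  sets \<open>D\<close> the full top-simplices, and the edge is maximal iff \<open>U\<close> and \<open>D\<close> both have two elements.
\<close>

section \<open>Adding a cell to a row\<close>

abbreviation row_len :: "nat list \<Rightarrow> nat \<Rightarrow> nat" where
  "row_len l \<equiv> nth_default 0 l"

definition inc :: "(nat \<Rightarrow> nat) \<Rightarrow> nat \<Rightarrow> nat \<Rightarrow> nat" where
  "inc f j = f(j := Suc (f j))"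

lemma inc_apply: "inc f j k = f k + (if k = j then 1 else 0)"
  by (simp add: inc_def)

lemma inc_commute: "inc (inc f i) j = inc (inc f j) i"
  by (auto simp: inc_apply fun_eq_iff)

lemma inc_cancel [simp]: "inc f i = inc g i \<longleftrightarrow> f = g"
  by (auto simp: inc_apply fun_eq_iff)

lemma inc_index_cancel [simp]: "inc f i = inc f j \<longleftrightarrow> i = j"
  by (auto simp: inc_apply fun_eq_iff split: if_splits)

text \<open>A sum of two unit vectors determines its unordered pair of indices.\<close>

lemma inc_inc_eq_iff: "inc (inc f p) q = inc (inc f i) j \<longleftrightarrow> p = i \<and> q = j \<or> p = j \<and> q = i"
proof
  assume eq: "inc (inc f p) q = inc (inc f i) j"
  have "p = i \<or> p = j"
    using fun_cong[OF eq, of p] by (auto simp: inc_apply split: if_splits)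
  then show "p = i \<and> q = j \<or> p = j \<and> q = i"
    using eq by (metis inc_commute inc_index_cancel)
qed (auto simp: inc_commute)

text \<open>Turns a difference that is a root into a common meet \<open>h\<close>. The truncated
  subtraction in its definition loses nothing, since the equation at \<open>i\<close> makes
  \<open>f i\<close> positive.\<close>

lemma inc_eq_incE:
  assumes "inc f j = inc g i" "i \<noteq> j"
  obtains h where "f = inc h i" "g = inc h j"
proof
  have *: "f k + (if k = j then 1 else 0) = g k + (if k = i then 1 else 0)" for k
    using fun_cong[OF assms(1), of k] by (simp add: inc_apply)
  define h where "h = f(i := f i - 1)"
  show "f = inc h i"
    using *[of i] assms(2) by (auto simp: h_def inc_apply fun_eq_iff)
  show "g = inc h j"
  proof
    fix k show "g k = inc h j k"
      using *[of k] assms(2) by (auto simp: h_def inc_apply split: if_splits)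
  qed
qed

text \<open>The meet \<open>f\<close> is the pointwise minimum and the join the pointwise maximum of
  the two functions, and both operations preserve antimonotonicity.\<close>

lemma antimono_inc_inc:
  assumes "antimono (inc f i)" "antimono (inc f j)" "i \<noteq> j"
  shows "antimono f" "antimono (inc (inc f i) j)"
proof -
  have "f = (\<lambda>k. min (inc f i k) (inc f j k))"
    using assms(3) by (auto simp: inc_apply fun_eq_iff)
  moreover have "antimono (\<lambda>k. min (inc f i k) (inc f j k))"
    using assms(1,2) by (intro antimonoI min.mono) (auto dest: antimonoD)
  ultimately show "antimono f" by simp
  have "inc (inc f i) j = (\<lambda>k. max (inc f i k) (inc f j k))"
    using assms(3) by (auto simp: inc_apply fun_eq_iff)
  moreover have "antimono (\<lambda>k. max (inc f i k) (inc f j k))"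
    using assms(1,2) by (intro antimonoI max.mono) (auto dest: antimonoD)
  ultimately show "antimono (inc (inc f i) j)" by simp
qed

text \<open>
  Comparing the three edges of a triangle \<open>a, b, x\<close> gives
  \<open>e\<^sub>j + e\<^sub>q + e\<^sub>r = e\<^sub>i + e\<^sub>p + e\<^sub>s\<close>; so \<open>x\<close> is above the meet or below the join of \<open>a\<close> and \<open>b\<close>.
\<close>

lemma root_triangle:
  assumes "inc a j = inc b i" "i \<noteq> j" "inc a p = inc x q" "p \<noteq> q" "inc b r = inc x s" "r \<noteq> s"
  shows "q = i \<or> p = j"
proof -
  have "inc a j k + inc x q k + inc b r k = inc b i k + inc a p k + inc x s k" for k
    using assms by simp
  then have *: "(if k = j then 1 else 0) + (if k = q then 1 else 0) + (if k = r then 1 else 0) =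
    (if k = i then 1 else 0) + (if k = p then 1 else 0) + (if k = s then 1::nat else 0)" for k
    by (simp add: inc_apply algebra_simps)
  show ?thesis
  proof (cases "q = i")
    case False
    \<comment> \<open>The unit vector at \<open>i\<close> on the right can only be matched by the
      one at \<open>r\<close>. Cancelling these two, the one at \<open>p\<close> must be matched by
      the one at \<open>j\<close>.\<close>
    then have "r = i" using *[of i] \<open>i \<noteq> j\<close> by (simp split: if_splits)
    then show ?thesis using *[of p] \<open>p \<noteq> q\<close> by (simp split: if_splits)
  qed simp
qed

lemma antimono_SucI: "(\<And>k. f (Suc k) \<le> f k) \<Longrightarrow> antimono (f :: nat \<Rightarrow> nat)"
  by (rule antimonoI) (rule lift_Suc_antimono_le)

lemma sum_inc: "j < N \<Longrightarrow> (\<Sum>k<N. inc f j k) = Suc (\<Sum>k<N. f k)"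
  by (simp add: inc_apply sum.distrib)

section \<open>Partitions as row length functions\<close>

lemma antimono_row_len: "l \<in> partitions n \<Longrightarrow> antimono (row_len l)"
  by (intro antimonoI)
    (auto simp: partitions_def nth_default_def sorted_wrt_iff_nth_less le_less)

lemma row_len_pos: "l \<in> partitions n \<Longrightarrow> 0 < row_len l k \<longleftrightarrow> k < length l"
  by (auto simp: partitions_def nth_default_def)

lemma sum_list_row_len:
  assumes "length l \<le> N"
  shows "sum_list l = (\<Sum>k<N. row_len l k)"
proof -
  have "sum_list l = (\<Sum>k<length l. row_len l k)"
    by (simp add: sum_list_sum_nth nth_default_def atLeast0LessThan)
  also have "\<dots> = (\<Sum>k<N. row_len l k)"
    using assms by (intro sum.mono_neutral_left) (auto simp: nth_default_def)
  finally show ?thesis .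
qed

text \<open>Equal row length functions mean that the lists agree up to trailing zeros, and the
  filter deletes those.\<close>

lemma filter_pos_cong:
  fixes xs ys :: "nat list"
  assumes "row_len xs = row_len ys"
  shows "filter ((<) 0) xs = filter ((<) 0) ys"
proof -
  have *: "filter ((<) 0) (strip_while ((=) 0) zs) = filter ((<) 0) zs" for zs :: "nat list"
    by (induction zs rule: rev_induct) auto
  show ?thesis
    using assms * unfolding nth_default_eq_iff by metis
qed

lemma filter_pos_partition: "l \<in> partitions n \<Longrightarrow> filter ((<) 0) l = l"
  by (auto simp: partitions_def intro: filter_True)

lemma row_len_inj:
  assumes "l \<in> partitions n" "m \<in> partitions n'" "row_len l = row_len m"
  shows "l = m"
  using filter_pos_cong[OF assms(3)] assms(1,2) by (simp add: filter_pos_partition)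

text \<open>The values of \<open>g\<close> are listed and trailing zeros stripped. The last
  remaining entry is nonzero, so by antimonotonicity all entries are positive.\<close>

lemma partition_of_antimono:
  assumes anti: "antimono g" and zero: "\<And>k. N \<le> k \<Longrightarrow> g k = 0"
  obtains m where "m \<in> partitions (\<Sum>k<N. g k)" "row_len m = g"
proof
  define m where "m = strip_while ((=) 0) (map g [0..<N])"
  have rl: "row_len m = g"
    using zero by (auto simp: m_def nth_default_def fun_eq_iff)
  show "row_len m = g" by fact
  have nth: "m ! k = g k" if "k < length m" for k
    using that rl by (metis nth_default_nth)
  have "0 < g k" if "k < length m" for k
  proof -
    have "m \<noteq> []" using that by auto
    then have "last m \<noteq> 0"
      using hd_dropWhile[of "(=) 0" "rev (map g [0..<N])"] by (auto simp: m_def strip_while_def last_rev)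
    then have "g (length m - 1) \<noteq> 0"
      using \<open>m \<noteq> []\<close> nth[of "length m - 1"] by (simp add: last_conv_nth)
    moreover have "g (length m - 1) \<le> g k"
      using that by (intro antimonoD[OF anti]) auto
    ultimately show ?thesis by linarith
  qed
  then have "\<forall>x\<in>set m. 0 < x"
    by (auto simp: in_set_conv_nth nth)
  moreover have "sorted_wrt (\<ge>) m"
    by (auto simp: sorted_wrt_iff_nth_less nth intro: antimonoD[OF anti])
  moreover have "length m \<le> N"
    by (simp add: m_def) (metis length_map length_strip_while_le length_upt minus_nat.diff_0)
  then have "sum_list m = (\<Sum>k<N. g k)"
    by (simp add: sum_list_row_len rl)
  ultimately show "m \<in> partitions (\<Sum>k<N. g k)"
    by (simp add: partitions_def)
qed

lemma partition_of_inc: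
  assumes "l \<in> partitions n" "antimono (inc (row_len l) j)"
  obtains m where "m \<in> partitions (Suc n)" "row_len m = inc (row_len l) j"
proof -
  \<comment> \<open>The range has to cover the rows of \<open>l\<close> and also row
    \<open>j\<close>, which may be empty in \<open>l\<close>.\<close>
  define N where "N = Suc (max (length l) j)"
  obtain m where m: "m \<in> partitions (\<Sum>k<N. inc (row_len l) j k)" "row_len m = inc (row_len l) j"
    by (rule partition_of_antimono[OF assms(2), of N])
      (auto simp: N_def inc_apply nth_default_beyond)
  have "(\<Sum>k<N. inc (row_len l) j k) = Suc (\<Sum>k<N. row_len l k)"
    by (intro sum_inc) (simp add: N_def)
  also have "\<dots> = Suc n"
    using assms(1) sum_list_row_len[of l N] by (simp add: N_def partitions_def)
  finally show ?thesis using m that by simp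
qed

lemma partition_of_move:
  assumes "l \<in> partitions n" "antimono g" "inc (row_len l) j = inc g i"
  obtains m where "m \<in> partitions n" "row_len m = g"
proof -
  define N where "N = Suc (max (length l) (max i j))"
  have g: "g k = 0" if "N \<le> k" for k
    using fun_cong[OF assms(3), of k] that by (auto simp: N_def inc_apply nth_default_beyond split: if_splits)
  obtain m where m: "m \<in> partitions (\<Sum>k<N. g k)" "row_len m = g"
    by (rule partition_of_antimono[OF assms(2) g])
  have "Suc (\<Sum>k<N. g k) = Suc (\<Sum>k<N. row_len l k)"
    using sum_inc[of j N "row_len l"] sum_inc[of i N g] assms(3) by (simp add: N_def)
  also have "\<dots> = Suc n"
    using assms(1) sum_list_row_len[of l N] by (simp add: N_def partitions_def)
  finally show ?thesis using m that by simp
qed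

section \<open>Moves and adjacency\<close>

lemma rev_sort_partition: "l \<in> partitions n \<Longrightarrow> rev (sort l) = l"
proof -
  assume "l \<in> partitions n"
  then have "sorted (rev l)"
    by (simp add: partitions_def sorted_wrt_rev)
  then have "sort l = rev l"
    by (intro properties_for_sort) auto
  then show ?thesis by simp
qed

lemma nth_snoc_0: "k \<le> length l \<Longrightarrow> (l @ [0]) ! k = row_len l k"
  by (auto simp: nth_default_def nth_append)

text \<open>When the changed row lengths already form a partition, \<open>move_cell\<close> only
  deletes a possible zero and sorting has no effect.\<close>

lemma move_cell_eqI:
  assumes l: "l \<in> partitions n" and m: "m \<in> partitions n"
    and eq: "inc (row_len l) j = inc (row_len m) i" and "i \<noteq> j"
  shows "i < length l" "j \<le> length l" "m = move_cell l i j"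
proof -
  have *: "row_len l k + (if k = j then 1 else 0) = row_len m k + (if k = i then 1 else 0)" for k
    using fun_cong[OF eq, of k] by (simp add: inc_apply)
  show i: "i < length l"
    using *[of i] \<open>i \<noteq> j\<close> row_len_pos[OF l, of i] by simp
  show j: "j \<le> length l"
  proof (rule ccontr)
    \<comment> \<open>Otherwise \<open>m\<close> would have a nonempty row \<open>j\<close> below
      the empty row \<open>length l\<close>.\<close>
    assume "\<not> j \<le> length l"
    then have "row_len m j \<le> row_len m (length l)"
      by (intro antimonoD[OF antimono_row_len[OF m]]) auto
    moreover have "row_len m (length l) = 0"
      using *[of "length l"] \<open>\<not> j \<le> length l\<close> by (auto simp: nth_default_beyond)
    ultimately show False using *[of j] \<open>i \<noteq> j\<close> by simp
  qed
  define r where "r = l @ [0]"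
  have "row_len (r[i := r ! i - 1, j := r ! j + 1]) k = row_len m k" for k
  proof (cases "k < length r")
    case True
    then have "row_len (r[i := r ! i - 1, j := r ! j + 1]) k = r[i := r ! i - 1, j := r ! j + 1] ! k"
      by (simp add: nth_default_def)
    also have "\<dots> = (if k = j then row_len l j + 1 else if k = i then row_len l i - 1 else row_len l k)"
      using i j True \<open>i \<noteq> j\<close> by (auto simp: nth_list_update nth_snoc_0 r_def less_Suc_eq_le)
    also have "\<dots> = row_len m k"
      using *[of k] \<open>i \<noteq> j\<close> by (auto split: if_splits)
    finally show ?thesis .
  next
    case False
    then show ?thesis using *[of k] i j
      by (auto simp: r_def nth_default_beyond split: if_splits)
  qed
  then have "filter ((<) 0) (r[i := r ! i - 1, j := r ! j + 1]) = m"
    using filter_pos_cong[of "r[i := r ! i - 1, j := r ! j + 1]" m] filter_pos_partition[OF m]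
    by (simp add: fun_eq_iff)
  then show "m = move_cell l i j"
    using rev_sort_partition[OF m] by (simp add: move_cell_def r_def Let_def)
qed

lemma mset_update2:
  assumes "i < length r" "j < length r" "i \<noteq> j"
  shows "mset (r[i := v, j := w]) = add_mset w (add_mset v (mset r - {#r ! i#}) - {#r ! j#})"
  using assms by (simp add: mset_update)

text \<open>Sorting leaves only the multiset of row lengths, and this depends on the lengths of the
  two rows but not on their positions.\<close>

lemma move_cell_cong:
  assumes "i < length l" "j \<le> length l" "i \<noteq> j" "i' < length l" "j' \<le> length l" "i' \<noteq> j'"
    and "row_len l i = row_len l i'" "row_len l j = row_len l j'"
  shows "move_cell l i j = move_cell l i' j'"
proof -
  define r where "r = l @ [0]"
  have eq: "r ! i = r ! i'" "r ! j = r ! j'"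
    using assms by (simp_all add: r_def nth_snoc_0 del: append.simps)
  have "mset (r[i := r ! i - 1, j := r ! j + 1]) = mset (r[i' := r ! i' - 1, j' := r ! j' + 1])"
    using assms eq by (subst (1 2) mset_update2) (auto simp: r_def)
  then have "sort (filter ((<) 0) (r[i := r ! i - 1, j := r ! j + 1]))
    = sort (filter ((<) 0) (r[i' := r ! i' - 1, j' := r ! j' + 1]))"
    by (intro properties_for_sort) auto
  then show ?thesis by (simp add: move_cell_def r_def Let_def)
qed

text \<open>For corner rows the changed lengths are still weakly decreasing, apart from one case
  that gives back \<open>l\<close>; so \<open>move_cell_eqI\<close> identifies the result.\<close>

lemma move_cell_corners:
  assumes l: "l \<in> partitions n"
    and i: "row_len l (Suc i) < row_len l i"
    and j: "antimono (inc (row_len l) j)" and ij: "i \<noteq> j"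
    and "move_cell l i j \<noteq> l"
  shows "move_cell l i j \<in> partitions n" "inc (row_len l) j = inc (row_len (move_cell l i j)) i"
proof -
  have i_len: "i < length l"
    using i row_len_pos[OF l, of i] by simp
  have mono: "row_len l (Suc k) \<le> row_len l k" for k
    using antimono_row_len[OF l] by (rule antimonoD) simp
  have j_prev: "row_len l j < row_len l k" if "Suc k = j" for k
    using antimonoD[OF j, of k j] that by (auto simp: inc_apply)
  have j_len: "j \<le> length l"
  proof (cases j)
    case (Suc k)
    then have "0 < row_len l k" using j_prev[of k] by simp
    then show ?thesis using Suc row_len_pos[OF l, of k] by simp
  qed simp
  \<comment> \<open>In the excluded case the move exchanges two row lengths, and sorting restores \<open>l\<close>.\<close>
  have no_swap: "\<not> (j = Suc i \<and> row_len l i = Suc (row_len l j))"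
  proof
    assume "j = Suc i \<and> row_len l i = Suc (row_len l j)"
    define r where "r = l @ [0]"
    have "r ! i - 1 = r ! j" "r ! j + 1 = r ! i"
      using \<open>j = Suc i \<and> _\<close> i_len j_len by (simp_all add: r_def nth_snoc_0 del: append.simps)
    then have "mset (r[i := r ! i - 1, j := r ! j + 1]) = mset (r[i := r ! j, j := r ! i])"
      by simp
    also have "\<dots> = mset r"
      using i_len j_len by (intro mset_swap) (auto simp: r_def)
    finally have "sort (filter ((<) 0) (r[i := r ! i - 1, j := r ! j + 1])) = sort (filter ((<) 0) r)"
      by (intro properties_for_sort) auto
    also have "\<dots> = sort l"
      using filter_pos_partition[OF l] by (simp add: r_def)
    finally have "move_cell l i j = l"
      using rev_sort_partition[OF l] by (simp add: move_cell_def r_def Let_def)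
    then show False using assms(5) by simp
  qed
  define g where "g = (row_len l)(i := row_len l i - 1, j := Suc (row_len l j))"
  have "antimono g"
  proof (rule antimono_SucI)
    fix k
    show "g (Suc k) \<le> g k"
      using mono[of k] j_prev[of k] i no_swap ij by (auto simp: g_def)
  qed
  moreover have eq: "inc (row_len l) j = inc g i"
    using i ij by (auto simp: g_def inc_apply fun_eq_iff)
  ultimately obtain m where m: "m \<in> partitions n" "row_len m = g"
    by (rule partition_of_move[OF l])
  then have "m = move_cell l i j"
    using eq ij by (intro move_cell_eqI(3)[OF l]) auto
  then show "move_cell l i j \<in> partitions n" "inc (row_len l) j = inc (row_len (move_cell l i j)) i"
    using m eq by auto
qed

text \<open>Sorting may permute rows, so the rows of the given move need not be those in which
  \<open>l\<close> and \<open>m\<close> differ; suitable rows have to be chosen.\<close>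

lemma obtained_by_moveE:
  assumes l: "l \<in> partitions n" and "obtained_by_move l m" "m \<noteq> l"
  obtains i j where "i \<noteq> j" "inc (row_len l) j = inc (row_len m) i"
proof -
  from assms(2) obtain i j where ij: "i < length l" "j \<le> length l" "i \<noteq> j" "m = move_cell l i j"
    by (auto simp: obtained_by_move_def)
  \<comment> \<open>A move between arbitrary rows equals, after sorting, the move from the last row as long as
    row \<open>i\<close> to the first row as long as row \<open>j\<close>, which are corner rows.\<close>
  define i' where "i' = (GREATEST k. row_len l k = row_len l i)"
  define j' where "j' = (LEAST k. row_len l k = row_len l j)"
  have bound: "k \<le> length l" if "row_len l k = row_len l i" for k
    using that ij(1) row_len_pos[OF l, of k] row_len_pos[OF l, of i] by simp
  have i': "row_len l i' = row_len l i"
    unfolding i'_def by (rule GreatestI_nat[OF refl bound])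
  have i'_ge: "k \<le> i'" if "row_len l k = row_len l i" for k
    unfolding i'_def using that bound by (rule Greatest_le_nat)
  have j': "row_len l j' = row_len l j"
    unfolding j'_def by (rule LeastI) (rule refl)
  have j'_le: "j' \<le> k" if "row_len l k = row_len l j" for k
    unfolding j'_def using that by (rule Least_le)
  \<comment> \<open>If they coincided, rows \<open>i\<close> and \<open>j\<close> would have equal
    length, and both would lie between \<open>j'\<close> and \<open>i'\<close>, forcing
    \<open>i = j\<close>.\<close>
  have neq: "i' \<noteq> j'"
    using i' j' i'_ge[of i] i'_ge[of j] j'_le[of i] j'_le[of j] ij(3) by auto
  have mono: "row_len l (Suc k) \<le> row_len l k" for k
    using antimono_row_len[OF l] by (rule antimonoD) simp
  have "row_len l (Suc i') \<noteq> row_len l i'"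
    using i' i'_ge[of "Suc i'"] by auto
  then have corner_i': "row_len l (Suc i') < row_len l i'"
    using mono[of i'] by simp
  have corner_j': "antimono (inc (row_len l) j')"
  proof (rule antimono_SucI)
    fix k
    have "row_len l k \<noteq> row_len l j'" if "Suc k = j'"
      using that j' j'_le[of k] by auto
    then show "inc (row_len l) j' (Suc k) \<le> inc (row_len l) j' k"
      using mono[of k] by (auto simp: inc_apply)
  qed
  have "i' < length l"
    using i' ij(1) row_len_pos[OF l, of i] row_len_pos[OF l, of i'] by simp
  moreover have "j' \<le> length l"
    using j'_le[of j] ij(2) by simp
  ultimately have m: "m = move_cell l i' j'"
    using ij i' j' neq by (auto intro: move_cell_cong)
  show thesis
    using that[OF neq] move_cell_corners(2)[OF l corner_i' corner_j' neq] m assms(3) by simp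
qed

lemma obtained_by_moveI:
  assumes "l \<in> partitions n" "m \<in> partitions n" "i \<noteq> j" "inc (row_len l) j = inc (row_len m) i"
  shows "obtained_by_move l m"
  using move_cell_eqI[OF assms(1,2,4,3)] assms(3) by (auto simp: obtained_by_move_def)

text \<open>The right-hand side is symmetric in \<open>l\<close> and \<open>m\<close>, which absorbs
  the two directions of a move.\<close>

lemma partition_graph_edges_iff:
  assumes l: "l \<in> partitions n" and m: "m \<in> partitions n"
  shows "{l, m} \<in> partition_graph_edges n \<longleftrightarrow>
    (\<exists>i j. i \<noteq> j \<and> inc (row_len l) j = inc (row_len m) i)" (is "_ \<longleftrightarrow> ?R")
proof
  assume "{l, m} \<in> partition_graph_edges n"
  then have "l \<noteq> m" "obtained_by_move l m \<or> obtained_by_move m l"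
    by (auto simp: partition_graph_edges_def doubleton_eq_iff)
  then show ?R
    using obtained_by_moveE[OF l] obtained_by_moveE[OF m] by metis
next
  assume R: ?R
  then have "l \<noteq> m" by auto
  moreover have "obtained_by_move l m"
    using R obtained_by_moveI[OF l m] by auto
  ultimately show "{l, m} \<in> partition_graph_edges n"
    using l m by (auto simp: partition_graph_edges_def)
qed

section \<open>Corners and transfers\<close>

text \<open>Here \<open>f\<close> is the diagram without the corner. As columns are counted from 0,
  the column of the corner is the length of the shortened row.\<close>

lemma removable_corner_iff:
  assumes l: "l \<in> partitions n"
  shows "removable_corner l c \<longleftrightarrow> (\<exists>f. antimono f \<and> row_len l = inc f (fst c) \<and> snd c = f (fst c))"
    (is "_ \<longleftrightarrow> ?R")
proof
  assume "removable_corner l c"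
  then obtain i where i: "row_len l (Suc i) < row_len l i" "c = (i, row_len l i - 1)"
    by (auto simp: removable_corner_def nth_default_nth)
  define f where "f = (row_len l)(i := row_len l i - 1)"
  have "antimono f"
  proof (rule antimono_SucI)
    fix k
    have "row_len l (Suc k) \<le> row_len l k"
      using antimono_row_len[OF l] by (rule antimonoD) simp
    then show "f (Suc k) \<le> f k" using i by (auto simp: f_def)
  qed
  moreover have "row_len l = inc f i"
    using i by (auto simp: f_def inc_apply fun_eq_iff)
  moreover have "f i = snd c"
    using i by (simp add: f_def)
  ultimately show ?R using i(2) by auto
next
  assume ?R
  then obtain f where f: "antimono f" "row_len l = inc f (fst c)" "snd c = f (fst c)" by blast
  have "f (Suc (fst c)) \<le> f (fst c)" using f(1) by (rule antimonoD) simp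
  moreover have "fst c < length l"
    using row_len_pos[OF l, of "fst c"] f by (simp add: inc_apply)
  moreover have "l ! fst c = Suc (f (fst c))"
    using calculation(2) f(2) by (metis nth_default_nth inc_def fun_upd_same)
  ultimately show "removable_corner l c"
    using f(2,3) by (auto simp: removable_corner_def inc_apply intro!: exI[of _ "fst c"] prod_eqI)
qed

lemma mem_ferrers_iff: "(i, j) \<in> ferrers l \<longleftrightarrow> j < row_len l i"
  by (auto simp: ferrers_def nth_default_def)

lemma addable_corner_iff:
  assumes l: "l \<in> partitions n"
  shows "addable_corner l a \<longleftrightarrow> antimono (inc (row_len l) (fst a)) \<and> snd a = row_len l (fst a)"
    (is "_ \<longleftrightarrow> ?R")
proof
  obtain i j where a: "a = (i, j)" by (cases a)
  assume "addable_corner l a"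
  then obtain m where m: "m \<in> partitions (Suc (sum_list l))"
    "\<And>p q. q < row_len m p \<longleftrightarrow> (p = i \<and> q = j) \<or> q < row_len l p" and nin: "\<not> j < row_len l i"
    by (auto simp: addable_corner_def a set_eq_iff mem_ferrers_iff)
  \<comment> \<open>Row \<open>i\<close> of \<open>m\<close> is an initial segment of columns, so
    the one new cell must come directly after row \<open>i\<close> of \<open>l\<close>.\<close>
  have j: "j = row_len l i" "row_len m i = Suc (row_len l i)"
    using nin m(2)[of _ i] by (metis less_Suc_eq less_irrefl linorder_neqE_nat not_less_eq)+
  have "row_len m = inc (row_len l) i"
  proof
    fix p show "row_len m p = inc (row_len l) i p"
    proof (cases "p = i")
      case False
      then have "q < row_len m p \<longleftrightarrow> q < row_len l p" for q
        using m(2) by simp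
      then have "row_len m p = row_len l p"
        by (metis linorder_neqE_nat less_irrefl)
      then show ?thesis using False by (simp add: inc_apply)
    qed (simp add: j inc_apply)
  qed
  then show ?R using j antimono_row_len[OF m(1)] by (simp add: a)
next
  assume R: ?R
  obtain m where m: "m \<in> partitions (Suc n)" "row_len m = inc (row_len l) (fst a)"
    using partition_of_inc[OF l] R by blast
  have "ferrers m = insert a (ferrers l)"
    using m(2) R by (cases a) (auto simp: set_eq_iff mem_ferrers_iff inc_apply)
  moreover have "a \<notin> ferrers l"
    using R by (cases a) (simp add: mem_ferrers_iff)
  ultimately show "addable_corner l a"
    using m(1) l by (auto simp: addable_corner_def partitions_def)
qed

lemma admissible_transfer:
  assumes l: "l \<in> partitions n" and adm: "admissible l c a"
  shows "corner_transfer l c a \<in> partitions n"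
    "inc (row_len l) (fst a) = inc (row_len (corner_transfer l c a)) (fst c)"
proof -
  from adm obtain f where f: "antimono f" "row_len l = inc f (fst c)"
    by (auto simp: admissible_def removable_corner_iff[OF l])
  have "row_len l (Suc (fst c)) < row_len l (fst c)"
    using antimonoD[OF f(1), of "fst c" "Suc (fst c)"] by (simp add: f(2) inc_apply)
  then show "corner_transfer l c a \<in> partitions n"
    "inc (row_len l) (fst a) = inc (row_len (corner_transfer l c a)) (fst c)"
    using adm move_cell_corners[OF l, of "fst c" "fst a"]
    by (auto simp: admissible_def corner_transfer_def addable_corner_iff[OF l])
qed

text \<open>Every neighbour arises from a transfer: the meet \<open>f\<close> gives the removable
  corner, the join the addable one, and both are antimonotone by
  \<open>antimono_inc_inc\<close>.\<close>

lemma admissibleI: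
  assumes l: "l \<in> partitions n" and m: "m \<in> partitions n" and "i \<noteq> j"
    and f: "row_len l = inc f i" "row_len m = inc f j"
  shows "admissible l (i, f i) (j, row_len l j)" "corner_transfer l (i, f i) (j, row_len l j) = m"
proof -
  show *: "corner_transfer l (i, f i) (j, row_len l j) = m"
    using move_cell_eqI(3)[OF l m _ \<open>i \<noteq> j\<close>] inc_commute[of f i j]
    unfolding f corner_transfer_def by simp
  have anti: "antimono f" "antimono (inc (inc f i) j)"
    using antimono_inc_inc[of f i j] antimono_row_len[OF l] antimono_row_len[OF m] f \<open>i \<noteq> j\<close> by auto
  have "m \<noteq> l" using f \<open>i \<noteq> j\<close> by auto
  then show "admissible l (i, f i) (j, row_len l j)"
    using m anti f(1) \<open>i \<noteq> j\<close> l unfolding admissible_def *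
    by (auto simp: removable_corner_iff[OF l] addable_corner_iff[OF l] partitions_def)
qed

section \<open>Star- and top-simplices as sets of covers\<close>

text \<open>The clique \<open>U\<close> of the overview. The meet stays a function, so it need not
  be realised as a list.\<close>

definition upper_covers :: "nat \<Rightarrow> (nat \<Rightarrow> nat) \<Rightarrow> nat list set" where
  "upper_covers n f = {l \<in> partitions n. \<exists>j. row_len l = inc f j}"

definition lower_covers :: "nat \<Rightarrow> (nat \<Rightarrow> nat) \<Rightarrow> nat list set" where
  "lower_covers n g = {l \<in> partitions n. \<exists>i. g = inc (row_len l) i}"

text \<open>Transferring \<open>c\<close> to \<open>a\<close> yields \<open>f\<close> with a cell
  added in the row of \<open>a\<close>, and that row fixes the addable corner. The bijection serves
  both to identify the star-simplex and to count it.\<close>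

lemma bij_betw_A_max:
  assumes l: "l \<in> partitions n" and f: "row_len l = inc f (fst c)" "snd c = f (fst c)"
  shows "bij_betw (corner_transfer l c) (A_max l c) (upper_covers n f - {l})"
proof -
  have row: "row_len (corner_transfer l c a) = inc f (fst a)" if "a \<in> A_max l c" for a
    using that admissible_transfer(2)[OF l, of c a] f by (simp add: A_max_def inc_commute)
  have snd: "snd a = row_len l (fst a)" if "a \<in> A_max l c" for a
    using that by (simp add: A_max_def admissible_def addable_corner_iff[OF l])
  show ?thesis
  proof (rule bij_betw_imageI)
    show "inj_on (corner_transfer l c) (A_max l c)"
    proof (rule inj_onI)
      fix a b assume ab: "a \<in> A_max l c" "b \<in> A_max l c" "corner_transfer l c a = corner_transfer l c b"
      then have "fst a = fst b" using row by (metis inc_index_cancel)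
      then show "a = b" using ab snd by (simp add: prod_eq_iff)
    qed
    show "corner_transfer l c ` A_max l c = upper_covers n f - {l}"
    proof (intro equalityI subsetI)
      fix m assume "m \<in> corner_transfer l c ` A_max l c"
      then show "m \<in> upper_covers n f - {l}"
        using row admissible_transfer(1)[OF l, of c] by (auto simp: upper_covers_def A_max_def admissible_def)
    next
      fix m assume "m \<in> upper_covers n f - {l}"
      then obtain j where m: "m \<in> partitions n" "row_len m = inc f j" "m \<noteq> l"
        by (auto simp: upper_covers_def)
      then have "fst c \<noteq> j" using f row_len_inj[OF m(1) l] by auto
      moreover have "(fst c, f (fst c)) = c" by (simp add: f(2)[symmetric])
      ultimately have "admissible l c (j, row_len l j)" "corner_transfer l c (j, row_len l j) = m"
        using admissibleI[OF l m(1) _ f(1) m(2)] by metis+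
      then show "m \<in> corner_transfer l c ` A_max l c"
        by (auto simp: A_max_def)
    qed
  qed
qed

lemma bij_betw_C_max:
  assumes l: "l \<in> partitions n" and a: "snd a = row_len l (fst a)"
  shows "bij_betw (\<lambda>c. corner_transfer l c a) (C_max l a) (lower_covers n (inc (row_len l) (fst a)) - {l})"
proof -
  have row: "inc (row_len l) (fst a) = inc (row_len (corner_transfer l c a)) (fst c)" if "c \<in> C_max l a" for c
    using that admissible_transfer(2)[OF l, of c a] by (simp add: C_max_def)
  have snd: "Suc (snd c) = row_len l (fst c)" if "c \<in> C_max l a" for c
    using that by (auto simp: C_max_def admissible_def removable_corner_iff[OF l] inc_apply)
  show ?thesis
  proof (rule bij_betw_imageI)
    show "inj_on (\<lambda>c. corner_transfer l c a) (C_max l a)"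
    proof (rule inj_onI)
      fix c d assume cd: "c \<in> C_max l a" "d \<in> C_max l a" "corner_transfer l c a = corner_transfer l d a"
      then have "fst c = fst d" using row by (metis inc_index_cancel)
      then show "c = d" using cd snd by (metis Suc_inject prod_eqI)
    qed
    show "(\<lambda>c. corner_transfer l c a) ` C_max l a = lower_covers n (inc (row_len l) (fst a)) - {l}"
    proof (intro equalityI subsetI)
      fix m assume "m \<in> (\<lambda>c. corner_transfer l c a) ` C_max l a"
      then show "m \<in> lower_covers n (inc (row_len l) (fst a)) - {l}"
        using row admissible_transfer(1)[OF l, of _ a] by (fastforce simp: lower_covers_def C_max_def admissible_def)
    next
      fix m assume "m \<in> lower_covers n (inc (row_len l) (fst a)) - {l}"
      then obtain i where m: "m \<in> partitions n" "inc (row_len l) (fst a) = inc (row_len m) i" "m \<noteq> l"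
        by (auto simp: lower_covers_def)
      \<comment> \<open>Equal rows would give \<open>m = l\<close>. With distinct rows, the meet of
        \<open>l\<close> and \<open>m\<close> locates the removable corner.\<close>
      then have "i \<noteq> fst a" using row_len_inj[OF m(1) l] by auto
      with m(2) obtain f where f: "row_len l = inc f i" "row_len m = inc f (fst a)"
        by (rule inc_eq_incE)
      moreover have "(fst a, row_len l (fst a)) = a" by (simp add: a[symmetric])
      ultimately have "admissible l (i, f i) a" "corner_transfer l (i, f i) a = m"
        using admissibleI[OF l m(1) \<open>i \<noteq> fst a\<close>] by metis+
      then show "m \<in> (\<lambda>c. corner_transfer l c a) ` C_max l a"
        by (auto simp: C_max_def)
    qed
  qed
qed

lemma star_simplex_eq:
  assumes "l \<in> partitions n" "row_len l = inc f (fst c)" "snd c = f (fst c)"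
  shows "star_simplex l c = upper_covers n f"
proof -
  have "l \<in> upper_covers n f" using assms by (auto simp: upper_covers_def)
  then show ?thesis
    using bij_betw_imp_surj_on[OF bij_betw_A_max[OF assms]]
    unfolding star_simplex_def Setcompr_eq_image by auto
qed

lemma top_simplex_eq:
  assumes "l \<in> partitions n" "snd a = row_len l (fst a)"
  shows "top_simplex l a = lower_covers n (inc (row_len l) (fst a))"
proof -
  have "l \<in> lower_covers n (inc (row_len l) (fst a))" using assms by (auto simp: lower_covers_def)
  then show ?thesis
    using bij_betw_imp_surj_on[OF bij_betw_C_max[OF assms]]
    unfolding top_simplex_def Setcompr_eq_image by auto
qed

section \<open>Finiteness and sizes of the cover sets\<close>

lemma finite_partitions: "finite (partitions n)"
proof (rule finite_subset)
  have "length l \<le> sum_list l" if "\<forall>x\<in>set l. 0 < x" for l :: "nat list"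
    using that by (induction l) auto
  then show "partitions n \<subseteq> {l. set l \<subseteq> {..n} \<and> length l \<le> n}"
    by (auto simp: partitions_def intro: member_le_sum_list)
  show "finite {l. set l \<subseteq> {..n} \<and> length l \<le> n}"
    by (rule finite_lists_length_le) simp
qed

lemma finite_upper_covers: "finite (upper_covers n f)"
  by (rule finite_subset[OF _ finite_partitions[of n]]) (auto simp: upper_covers_def)

lemma finite_lower_covers: "finite (lower_covers n g)"
  by (rule finite_subset[OF _ finite_partitions[of n]]) (auto simp: lower_covers_def)

text \<open>The successor accounts for \<open>l\<close> itself; thus two admissible targets
  correspond to a simplex with three vertices.\<close>

lemma card_A_max:
  assumes "l \<in> partitions n" "row_len l = inc f (fst c)" "snd c = f (fst c)"
  shows "card (upper_covers n f) = Suc (card (A_max l c))"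
proof -
  have "l \<in> upper_covers n f" using assms by (auto simp: upper_covers_def)
  from card.remove[OF finite_upper_covers this] show ?thesis
    using bij_betw_same_card[OF bij_betw_A_max[OF assms]] by simp
qed

lemma card_C_max:
  assumes "l \<in> partitions n" "snd a = row_len l (fst a)"
  shows "card (lower_covers n (inc (row_len l) (fst a))) = Suc (card (C_max l a))"
proof -
  have "l \<in> lower_covers n (inc (row_len l) (fst a))" using assms by (auto simp: lower_covers_def)
  from card.remove[OF finite_lower_covers this] show ?thesis
    using bij_betw_same_card[OF bij_betw_C_max[OF assms]] by simp
qed

section \<open>Maximal cliques\<close>

lemma upper_covers_in_complex:
  assumes "upper_covers n f \<noteq> {}"
  shows "upper_covers n f \<in> partition_complex n"
proof -
  have "{l, m} \<in> partition_graph_edges n" if lm: "l \<in> upper_covers n f" "m \<in> upper_covers n f" "l \<noteq> m" for l m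
  proof -
    obtain i j where ij: "l \<in> partitions n" "m \<in> partitions n" "row_len l = inc f i" "row_len m = inc f j"
      using lm by (auto simp: upper_covers_def)
    then have "i \<noteq> j" using \<open>l \<noteq> m\<close> row_len_inj by auto
    then show ?thesis
      unfolding partition_graph_edges_iff[OF ij(1,2)] ij(3,4) using inc_commute by blast
  qed
  then show ?thesis
    using assms finite_upper_covers
    by (auto simp: partition_complex_def clique_complex_def clique_def upper_covers_def)
qed

lemma lower_covers_in_complex:
  assumes "lower_covers n g \<noteq> {}"
  shows "lower_covers n g \<in> partition_complex n"
proof -
  have "{l, m} \<in> partition_graph_edges n" if lm: "l \<in> lower_covers n g" "m \<in> lower_covers n g" "l \<noteq> m" for l m
  proof -
    obtain i j where ij: "l \<in> partitions n" "m \<in> partitions n" "inc (row_len l) j = inc (row_len m) i"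
      using lm by (force simp: lower_covers_def)
    then have "i \<noteq> j" using \<open>l \<noteq> m\<close> row_len_inj by auto
    then show ?thesis
      unfolding partition_graph_edges_iff[OF ij(1,2)] using ij(3) by blast
  qed
  then show ?thesis
    using assms finite_lower_covers
    by (auto simp: partition_complex_def clique_complex_def clique_def lower_covers_def)
qed

text \<open>A common member adds one cell to \<open>f\<close> and lies one cell below the join, so
  by \<open>inc_inc_eq_iff\<close> its cell is in row \<open>i\<close> or \<open>j\<close>.\<close>

lemma upper_lower_covers_inter:
  assumes "l \<in> partitions n" "m \<in> partitions n" "row_len l = inc f i" "row_len m = inc f j"
  shows "upper_covers n f \<inter> lower_covers n (inc (inc f i) j) \<subseteq> {l, m}"
  using assms row_len_inj by (auto simp: upper_covers_def lower_covers_def inc_inc_eq_iff)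

text \<open>The central dichotomy. Triangles with the edge \<open>l, m\<close> place each vertex in
  \<open>U\<close> or \<open>D\<close>; a vertex only in \<open>U\<close> and a vertex only in
  \<open>D\<close> cannot be adjacent.\<close>

lemma simplex_subset_covers:
  assumes S: "S \<in> partition_complex n" and "l \<in> S" "m \<in> S" and "i \<noteq> j"
    and l: "row_len l = inc f i" and m: "row_len m = inc f j"
  shows "S \<subseteq> upper_covers n f \<or> S \<subseteq> lower_covers n (inc (inc f i) j)"
proof -
  let ?U = "upper_covers n f" and ?D = "lower_covers n (inc (inc f i) j)"
  have part: "x \<in> partitions n" if "x \<in> S" for x
    using S that by (auto simp: partition_complex_def clique_complex_def)
  have adj: "\<exists>q p. q \<noteq> p \<and> inc (row_len x) p = inc (row_len y) q"
    if "x \<in> S" "y \<in> S" "x \<noteq> y" for x y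
  proof -
    have "{x, y} \<in> partition_graph_edges n"
      using S that by (auto simp: partition_complex_def clique_complex_def clique_def)
    then show ?thesis
      by (rule iffD1[OF partition_graph_edges_iff[OF part[OF that(1)] part[OF that(2)]]])
  qed
  have UD: "x \<in> ?U \<or> x \<in> ?D" if x: "x \<in> S" for x
  proof (cases "x = l \<or> x = m")
    case True
    then show ?thesis using part[OF x] l m by (auto simp: upper_covers_def)
  next
    case False
    then obtain p q r s where pq: "p \<noteq> q" "inc (row_len l) p = inc (row_len x) q"
      and rs: "r \<noteq> s" "inc (row_len m) r = inc (row_len x) s"
      using adj[of l x] adj[of m x] assms(2,3) x by metis
    have "q = i \<or> p = j"
      by (rule root_triangle[OF _ \<open>i \<noteq> j\<close> pq(2,1) rs(2,1)]) (simp add: l m inc_commute)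
    then show ?thesis
    proof
      assume "q = i"
      then have "inc (inc f p) i = inc (row_len x) i" using pq(2) l by (simp add: inc_commute)
      then have "row_len x = inc f p" by simp
      then show ?thesis using part[OF x] by (auto simp: upper_covers_def)
    next
      assume "p = j"
      then show ?thesis using part[OF x] pq(2) l by (auto simp: lower_covers_def)
    qed
  qed
  show ?thesis
  proof (rule ccontr)
    assume "\<not> ?thesis"
    then obtain x y where xy: "x \<in> S" "x \<notin> ?D" "y \<in> S" "y \<notin> ?U" by auto
    then obtain p q where p: "row_len x = inc f p" and q: "inc (row_len y) q = inc (inc f i) j"
      using UD[of x] UD[of y] by (force simp: upper_covers_def lower_covers_def)
    have "p \<noteq> i" "p \<noteq> j"
      using xy(1,2) part[of x] p by (auto simp: lower_covers_def inc_inc_eq_iff)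
    moreover have "row_len y \<noteq> inc f k" for k
      using xy(3,4) part[of y] by (auto simp: upper_covers_def)
    then have "q \<noteq> i" "q \<noteq> j"
      using q by (metis inc_commute inc_cancel)+
    moreover have "x \<noteq> y" using xy UD by blast
    then obtain s t where "s \<noteq> t" "inc (row_len x) s = inc (row_len y) t"
      using adj[OF xy(1,3)] by metis
    \<comment> \<open>Since \<open>p\<close> and \<open>q\<close> avoid \<open>i\<close> and
      \<open>j\<close>, the unit vectors at both \<open>i\<close> and \<open>j\<close> would have to
      be matched by the single one at \<open>s\<close>.\<close>
    then have "inc (inc (inc f p) q) s k = inc (inc (inc f i) j) t k" for k
      using p q by (metis inc_commute)
    then have *: "(if k = p then 1 else 0) + (if k = q then 1 else 0) + (if k = s then 1 else 0) =
      (if k = i then 1 else 0) + (if k = j then 1 else 0) + (if k = t then 1::nat else 0)" for k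
      by (simp add: inc_apply algebra_simps)
    ultimately show False
      using *[of i] *[of j] \<open>i \<noteq> j\<close> by (auto split: if_splits)
  qed
qed

text \<open>A simplex containing \<open>U\<close> contains the edge \<open>l, m\<close>, so it lies
  in \<open>U\<close> or \<open>D\<close>. The second is impossible, because \<open>U\<close> has a
  third vertex and \<open>D\<close> meets it only in the edge.\<close>

lemma maximal_upper_covers:
  assumes "l \<in> partitions n" "m \<in> partitions n" "i \<noteq> j" "row_len l = inc f i" "row_len m = inc f j"
    and "2 < card (upper_covers n f)"
  shows "upper_covers n f \<in> maximal_simplices (partition_complex n)"
proof -
  let ?U = "upper_covers n f" and ?D = "lower_covers n (inc (inc f i) j)"
  have lm: "l \<in> ?U" "m \<in> ?U" using assms by (auto simp: upper_covers_def)
  have "\<not> ?U \<subseteq> ?D"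
  proof
    assume "?U \<subseteq> ?D"
    then have "?U \<subseteq> {l, m}"
      using upper_lower_covers_inter[OF assms(1,2,4,5)] by blast
    then show False
      using assms(6) card_mono[of "{l, m}" ?U] card_2_iff' by (auto simp: card_insert_if split: if_splits)
  qed
  then have "\<not> ?U \<subset> T" if "T \<in> partition_complex n" for T
    using simplex_subset_covers[OF that _ _ assms(3-5)] lm by blast
  then show ?thesis
    using upper_covers_in_complex[of n f] lm by (auto simp: maximal_simplices_def)
qed

lemma maximal_lower_covers:
  assumes "l \<in> partitions n" "m \<in> partitions n" "i \<noteq> j" "row_len l = inc f i" "row_len m = inc f j"
    and "2 < card (lower_covers n (inc (inc f i) j))"
  shows "lower_covers n (inc (inc f i) j) \<in> maximal_simplices (partition_complex n)"
proof -
  let ?U = "upper_covers n f" and ?D = "lower_covers n (inc (inc f i) j)"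
  have lm: "l \<in> ?D" "m \<in> ?D" using assms by (auto simp: lower_covers_def inc_commute)
  have "\<not> ?D \<subseteq> ?U"
  proof
    assume "?D \<subseteq> ?U"
    then have "?D \<subseteq> {l, m}"
      using upper_lower_covers_inter[OF assms(1,2,4,5)] by blast
    then show False
      using assms(6) card_mono[of "{l, m}" ?D] card_2_iff' by (auto simp: card_insert_if split: if_splits)
  qed
  then have "\<not> ?D \<subset> T" if "T \<in> partition_complex n" for T
    using simplex_subset_covers[OF that _ _ assms(3-5)] lm by blast
  then show ?thesis
    using lower_covers_in_complex[of n "inc (inc f i) j"] lm by (auto simp: maximal_simplices_def)
qed

text \<open>Rules out isolated vertices, hence maximal simplices with one vertex, as soon as there
  are two cells.\<close>

lemma partition_complex_neighbour:
  assumes "2 \<le> n" and l: "l \<in> partitions n"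
  obtains m i j f where "m \<in> partitions n" "i \<noteq> j" "row_len l = inc f i" "row_len m = inc f j"
proof -
  have "l \<noteq> []" using assms by (auto simp: partitions_def)
  \<comment> \<open>The end of the last row is always removable. Its cell goes to the first row, or
    to a new second row if there is only one row.\<close>
  define i where "i = length l - 1"
  define f where "f = (row_len l)(i := row_len l i - 1)"
  define j where "j = (if length l = 1 then 1 else 0 :: nat)"
  have "0 < row_len l i"
    using \<open>l \<noteq> []\<close> by (simp add: row_len_pos[OF l] i_def)
  then have lf: "row_len l = inc f i"
    by (auto simp: f_def inc_apply fun_eq_iff)
  have ij: "i \<noteq> j"
    using \<open>l \<noteq> []\<close> by (cases l) (auto simp: i_def j_def)
  have "antimono (inc f j)"
  proof (rule antimono_SucI)
    fix k
    have mono: "row_len l (Suc k) \<le> row_len l k"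
      using antimono_row_len[OF l] by (rule antimonoD) simp
    show "inc f j (Suc k) \<le> inc f j k"
    proof (cases "length l = 1")
      case True
      then have "row_len l 0 = n"
        using l by (cases l) (auto simp: partitions_def)
      moreover have "row_len l (Suc k) = 0"
        using True by (simp add: nth_default_beyond)
      ultimately show ?thesis
        using True assms(1) by (auto simp: inc_apply f_def i_def j_def)
    next
      case False
      then show ?thesis
        using mono \<open>l \<noteq> []\<close> by (auto simp: inc_apply f_def i_def j_def nth_default_beyond)
    qed
  qed
  then obtain m where "m \<in> partitions n" "row_len m = inc f j"
    by (rule partition_of_move[OF l, of _ j i]) (simp add: lf inc_commute)
  then show thesis using that ij lf by blast
qed

lemma maximal_simplex_cases:
  assumes "2 \<le> n" and S: "S \<in> maximal_simplices (partition_complex n)"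
  obtains
    (star) l c where "l \<in> partitions n" "removable_corner l c" "2 \<le> card (A_max l c)" "S = star_simplex l c"
  | (top) l a where "l \<in> partitions n" "addable_corner l a" "2 \<le> card (C_max l a)" "S = top_simplex l a"
  | (edge) l c a where "l \<in> partitions n" "admissible l c a" "card (A_max l c) = 1" "card (C_max l a) = 1"
      "S = {l, corner_transfer l c a}"
proof -
  have SK: "S \<in> partition_complex n" and max: "\<And>T. T \<in> partition_complex n \<Longrightarrow> S \<subseteq> T \<Longrightarrow> S = T"
    using S by (auto simp: maximal_simplices_def)
  then obtain l where l: "l \<in> S" "l \<in> partitions n"
    by (auto simp: partition_complex_def clique_complex_def)
  have "S \<noteq> {l}"
  proof
    assume "S = {l}"
    obtain m i j f where m: "m \<in> partitions n" "i \<noteq> j" "row_len l = inc f i" "row_len m = inc f j"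
      by (rule partition_complex_neighbour[OF assms(1) l(2)])
    then have lm: "l \<in> upper_covers n f" "m \<in> upper_covers n f"
      using l by (auto simp: upper_covers_def)
    then have "S = upper_covers n f"
      using \<open>S = {l}\<close> by (intro max upper_covers_in_complex) auto
    then have "m = l" using \<open>S = {l}\<close> lm by blast
    then show False using m by simp
  qed
  then obtain m where m: "m \<in> S" "m \<in> partitions n" "m \<noteq> l"
    using l SK by (auto simp: partition_complex_def clique_complex_def)
  then have "{l, m} \<in> partition_graph_edges n"
    using SK l by (auto simp: partition_complex_def clique_complex_def clique_def)
  then obtain i j where ij: "i \<noteq> j" "inc (row_len l) j = inc (row_len m) i"
    using partition_graph_edges_iff[OF l(2) m(2)] by blast
  obtain f where f: "row_len l = inc f i" "row_len m = inc f j"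
    using inc_eq_incE[OF ij(2,1)] .
  let ?c = "(i, f i)" and ?a = "(j, row_len l j)"
  let ?U = "upper_covers n f" and ?D = "lower_covers n (inc (inc f i) j)"
  have adm: "admissible l ?c ?a" and ct: "corner_transfer l ?c ?a = m"
    using admissibleI[OF l(2) m(2) ij(1) f] by auto
  have U: "star_simplex l ?c = ?U" "card ?U = Suc (card (A_max l ?c))"
    using star_simplex_eq[OF l(2), of f ?c] card_A_max[OF l(2), of f ?c] f by auto
  have D: "top_simplex l ?a = ?D" "card ?D = Suc (card (C_max l ?a))"
    using top_simplex_eq[OF l(2), of ?a] card_C_max[OF l(2), of ?a] f by auto
  have lm: "{l, m} \<subseteq> ?U" "{l, m} \<subseteq> ?D" "card {l, m} = 2"
    using l m f by (auto simp: upper_covers_def lower_covers_def inc_commute)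
  then have ge: "2 \<le> card ?U" "2 \<le> card ?D"
    using card_mono[OF finite_upper_covers] card_mono[OF finite_lower_covers] by metis+
  have K: "?U \<in> partition_complex n" "?D \<in> partition_complex n"
    using lm by (intro upper_covers_in_complex lower_covers_in_complex; blast)+
  \<comment> \<open>\<open>S\<close> lies in one of these two simplices and is maximal. Both contain
    \<open>{l, m}\<close>, so if the one equal to \<open>S\<close> has two elements,
    \<open>S\<close> is the edge; otherwise it is a star or top of the required size.\<close>
  have "S = ?U \<or> S = ?D"
    using simplex_subset_covers[OF SK l(1) m(1) ij(1) f] max[OF K(1)] max[OF K(2)] by blast
  moreover have thesis if "S = {l, m}"
  proof -
    have "S = ?U" "S = ?D" using lm K max that by blast+
    then have "card (A_max l ?c) = 1" "card (C_max l ?a) = 1"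
      using U(2) D(2) lm(3) that by auto
    then show thesis using edge[OF l(2) adm] that ct by simp
  qed
  moreover have "{l, m} = ?U" if "card ?U = 2"
    using lm that finite_upper_covers by (intro card_subset_eq) auto
  moreover have "{l, m} = ?D" if "card ?D = 2"
    using lm that finite_lower_covers by (intro card_subset_eq) auto
  moreover have thesis if "S = ?U" "card ?U \<noteq> 2"
    using star[OF l(2), of ?c] adm U ge that by (simp add: admissible_def)
  moreover have thesis if "S = ?D" "card ?D \<noteq> 2"
    using top[OF l(2), of ?a] adm D ge that by (simp add: admissible_def)
  ultimately show thesis by metis
qed

lemma maximal_star_simplex:
  assumes l: "l \<in> partitions n" and c: "removable_corner l c" "2 \<le> card (A_max l c)"
  shows "star_simplex l c \<in> maximal_simplices (partition_complex n)"
proof -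
  obtain f where f: "row_len l = inc f (fst c)" "snd c = f (fst c)"
    using c(1) by (auto simp: removable_corner_iff[OF l])
  have card: "2 < card (upper_covers n f)"
    using card_A_max[OF l f] c(2) by simp
  \<comment> \<open>A second vertex is needed to fix the edge to which the dichotomy is
    applied.\<close>
  then have "\<not> upper_covers n f \<subseteq> {l}"
    using card_mono[of "{l}" "upper_covers n f"] by auto
  then obtain m j where m: "m \<in> partitions n" "m \<noteq> l" "row_len m = inc f j"
    by (auto simp: upper_covers_def)
  then have "fst c \<noteq> j" using row_len_inj[OF m(1) l] f(1) by auto
  then show ?thesis
    using maximal_upper_covers[OF l m(1) _ f(1) m(3) card] star_simplex_eq[OF l f] by simp
qed

lemma maximal_top_simplex:
  assumes l: "l \<in> partitions n" and a: "addable_corner l a" "2 \<le> card (C_max l a)"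
  shows "top_simplex l a \<in> maximal_simplices (partition_complex n)"
proof -
  let ?D = "lower_covers n (inc (row_len l) (fst a))"
  have a': "snd a = row_len l (fst a)"
    using a(1) by (auto simp: addable_corner_iff[OF l])
  have card: "2 < card ?D"
    using card_C_max[OF l a'] a(2) by simp
  then have "\<not> ?D \<subseteq> {l}"
    using card_mono[of "{l}" ?D] by auto
  then obtain m i where m: "m \<in> partitions n" "m \<noteq> l" "inc (row_len l) (fst a) = inc (row_len m) i"
    by (auto simp: lower_covers_def)
  then have "i \<noteq> fst a" using row_len_inj[OF m(1) l] by auto
  then obtain f where f: "row_len l = inc f i" "row_len m = inc f (fst a)"
    using inc_eq_incE[OF m(3)] by metis
  show ?thesis
    using maximal_lower_covers[OF l m(1) \<open>i \<noteq> fst a\<close> f] card f(1) top_simplex_eq[OF l a'] by simp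
qed

text \<open>Both cardinality conditions together make \<open>U\<close> and \<open>D\<close> equal to
  the edge, so the dichotomy leaves no larger simplex.\<close>

lemma maximal_edge:
  assumes l: "l \<in> partitions n" and adm: "admissible l c a"
    and cards: "card (A_max l c) = 1" "card (C_max l a) = 1"
  shows "{l, corner_transfer l c a} \<in> maximal_simplices (partition_complex n)"
proof -
  define m where "m = corner_transfer l c a"
  have m: "m \<in> partitions n" "inc (row_len l) (fst a) = inc (row_len m) (fst c)" "m \<noteq> l" "fst c \<noteq> fst a"
    using admissible_transfer[OF l adm] adm by (auto simp: m_def admissible_def)
  obtain f where f: "row_len l = inc f (fst c)" "snd c = f (fst c)"
    using adm by (auto simp: admissible_def removable_corner_iff[OF l])
  have a: "snd a = row_len l (fst a)"
    using adm by (auto simp: admissible_def addable_corner_iff[OF l])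
  have fm: "row_len m = inc f (fst a)"
    using m(2) f(1) by (simp add: inc_commute)
  let ?U = "upper_covers n f" and ?D = "lower_covers n (inc (inc f (fst c)) (fst a))"
  have sub: "{l, m} \<subseteq> ?U" "{l, m} \<subseteq> ?D"
  proof -
    have "m \<in> ?D"
      using m(1) fm by (simp add: lower_covers_def) (metis inc_commute)
    then show "{l, m} \<subseteq> ?U" "{l, m} \<subseteq> ?D"
      using l m(1) f(1) fm by (auto simp: upper_covers_def lower_covers_def)
  qed
  moreover have "card ?U = 2" "card ?D = 2"
    using card_A_max[OF l f] card_C_max[OF l a] cards f by auto
  ultimately have eq: "{l, m} = ?U" "{l, m} = ?D"
    using m(3) card_subset_eq[OF finite_upper_covers sub(1)] card_subset_eq[OF finite_lower_covers sub(2)]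
    by auto
  then have "{l, m} \<in> partition_complex n"
    using upper_covers_in_complex[of n f] by auto
  moreover have "\<not> {l, m} \<subset> T" if "T \<in> partition_complex n" for T
    using simplex_subset_covers[OF that _ _ m(4) f(1) fm] eq by blast
  ultimately show ?thesis by (auto simp: maximal_simplices_def m_def)
qed

section \<open>The one-vertex case and the full classification\<close>

lemma partitions_1: "partitions 1 = {[1]}"
proof (intro equalityI subsetI)
  fix l assume "l \<in> partitions 1"
  then show "l \<in> {[1]}"
    by (cases l; cases "tl l") (auto simp: partitions_def)
qed (simp add: partitions_def)

theorem corollary3p12:
  fixes n :: nat
  assumes "n \<ge> 1"
  shows "(n \<ge> 2 \<longrightarrow>
            maximal_simplices (partition_complex n) =
              {star_simplex l c | l c.
                 l \<in> partitions n \<and> removable_corner l c \<and> card (A_max l c) \<ge> 2} \<union>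
              {top_simplex l a | l a.
                 l \<in> partitions n \<and> addable_corner l a \<and> card (C_max l a) \<ge> 2} \<union>
              {{l, corner_transfer l c a} | l c a.
                 l \<in> partitions n \<and> admissible l c a \<and>
                 card (A_max l c) = 1 \<and> card (C_max l a) = 1}) \<and>
         (n = 1 \<longrightarrow> maximal_simplices (partition_complex n) = {{[1]}})"
proof (intro conjI impI equalityI subsetI)
  fix S assume "n \<ge> 2" "S \<in> maximal_simplices (partition_complex n)"
  then show "S \<in> {star_simplex l c | l c.
                 l \<in> partitions n \<and> removable_corner l c \<and> card (A_max l c) \<ge> 2} \<union>
              {top_simplex l a | l a.
                 l \<in> partitions n \<and> addable_corner l a \<and> card (C_max l a) \<ge> 2} \<union>
              {{l, corner_transfer l c a} | l c a.
                 l \<in> partitions n \<and> admissible l c a \<and>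
                 card (A_max l c) = 1 \<and> card (C_max l a) = 1}"
    by (cases rule: maximal_simplex_cases) blast+
next
  fix S assume "S \<in> {star_simplex l c | l c.
                 l \<in> partitions n \<and> removable_corner l c \<and> card (A_max l c) \<ge> 2} \<union>
              {top_simplex l a | l a.
                 l \<in> partitions n \<and> addable_corner l a \<and> card (C_max l a) \<ge> 2} \<union>
              {{l, corner_transfer l c a} | l c a.
                 l \<in> partitions n \<and> admissible l c a \<and>
                 card (A_max l c) = 1 \<and> card (C_max l a) = 1}"
  then show "S \<in> maximal_simplices (partition_complex n)"
    using maximal_star_simplex maximal_top_simplex maximal_edge by blast
next
  fix S assume "n = 1" "S \<in> maximal_simplices (partition_complex n)"
  then show "S \<in> {{[1]}}"
    using partitions_1 by (auto simp: maximal_simplices_def partition_complex_def clique_complex_def)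
next
  fix S assume "n = 1" "S \<in> {{[1::nat]}}"
  then show "S \<in> maximal_simplices (partition_complex n)"
    using partitions_1
    by (auto simp: maximal_simplices_def partition_complex_def clique_complex_def clique_def)
qed

end
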